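(* Let $F$ be an $L$-layered bisemifield$^\dagger$ and $S\subseteq F^{(n)}$. For congruences $\Omega_1,\Omega_2$ on $\mathrm{Fun}(S,F)$, if $\Omega_1\supseteq\Omega_2$ then $V(\Omega_1)\subseteq V(\Omega_2)$. Conversely, for nonempty subsets $X,Y$ of $S$, if $Y\supseteq X$ then $\Omega_Y\subseteq\Omega_X$. Consequently, for a congruence $\Omega$ on $\mathrm{Fun}(S,F)$ and a nonempty subset $X\subseteq S$, $$V(\Omega_{V(\Omega)})=V(\Omega)\qquad\text{and}\qquad\Omega_{V(\Omega_X)}=\Omega_X .$$ It follows that there is a 1:1 correspondence between congruences of varieties and varieties of congruences, given by $X\mapsto\Omega_X$ and $\Omega\mapsto V(\Omega)$. Furthermore, for a congruence $\Omega$ on $\mathrm{Fun}(S,F)$, the coordinate semiring$^\dagger$ satisfies $$F[V(\Omega)]\cong\mathrm{Pol}(S,F)/\Omega .$$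
   Context: All monoids are commutative. A semiring$^\dagger$ is a semiring with multiplicative unit but not necessarily with zero. A congruence $\Omega$ on a semiring$^\dagger$ is an equivalence relation (regarded as a set of pairs) compatible with addition and multiplication. A partial pre-order is a transitive relation (understood to be reflexive). $L$ is a semiring$^\dagger$ with a partial pre-order $\ge$ respected by addition and multiplication, all of whose nonzero elements are positive, so that $\ell+k\ge\ell$; if $L$ has an infinite element $\infty$, then $\infty+a=\infty=\infty\cdot a$. An $L$-layered pre-domain$^\dagger$ is a semiring$^\dagger$ $R$ with a partition $R=\dot\bigcup_{\ell\in L}R_\ell$ and maps $\nu_{m,\ell}:R_\ell\to R_m$ for $m\ge\ell$, with $\nu_{\ell,\ell}=\mathrm{id}$ and $\nu_{m,\ell}\circ\nu_{\ell,k}=\nu_{m,k}$ for $m\ge\ell\ge k$. For $a\in R_k,b\in R_\ell$ write $a\cong_\nu b$ if $\nu_{m,k}(a)=\nu_{m,\ell}(b)$ for some $m\ge k,\ell$. Axioms: (A1) $1_R\in R_1$. (A2) $R_kR_\ell\subseteq R_{k\ell}$. (A3) $\nu_{m,k}(a)\nu_{m',\ell}(b)=\nu_{mm',k\ell}(ab)$ for $a\in R_k$, $b\in R_\ell$, $m\ge k$, $m'\ge\ell$. (A4) $\nu_{\ell,k}(a)+\nu_{\ell',k}(a)=\nu_{\ell+\ell',k}(a)$ for $a\in R_k$, $\ell,\ell'\ge k$. (B) If $a\in R_k$, $b\in R_\ell$, $a\cong_\nu b$, then $a+b\in R_{k+\ell}$ and $a+b\cong_\nu a$; if moreover $k=\infty$,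 then $a+b=a$. An $L$-layered bidomain$^\dagger$ is an $L$-layered pre-domain$^\dagger$ that is $\nu$-bipotent ($a+b\cong_\nu a$ or $a+b\cong_\nu b$ for all $a,b$) and multiplicatively cancellative; it is an $L$-layered bisemifield$^\dagger$ if moreover $(R_1,\cdot)$ is an abelian group. $\mathrm{Fun}(S,F)$ is the semiring$^\dagger$ of functions $S\to F$ under pointwise operations. $\mathrm{Pol}(S,F)$ is its sub-semiring$^\dagger$ of polynomial functions, i.e. the image of $F[\lambda_1,\dots,\lambda_n]$ in $\mathrm{Fun}(S,F)$. For $X\subseteq S$, the coordinate semiring$^\dagger$ $F[X]$ is (the natural image of) $\mathrm{Pol}(X,F)$, the semiring$^\dagger$ of polynomial functions on $X$. For a nonempty subset $X\subseteq S$, the congruence $\Omega_X$ of $X$ on $\mathrm{Fun}(S,F)$ consists of all pairs $(f,g)$ with $f(\mathbf a)=g(\mathbf a)$ for every $\mathbf a\in X$. For a congruence $\Omega$ on $\mathrm{Fun}(S,F)$, the variety of the congruence is $V(\Omega)=\{\mathbf a\in S:f(\mathbf a)=g(\mathbf a)\ \text{for all }(f,g)\in\Omega\}$. A congruence of a variety is a congruence of the form $\Omega_X$; a variety of a congruence is a set of the form $V(\Omega)$. $\mathrm{Pol}(S,F)/\Omega$ denotes the quotient of $\mathrm{Pol}(S,F)$ by the restriction of $\Omega$ to it.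
   Formalization: The final isomorphism, false for arbitrary Ω (e.g. over (ℤ,max,+)), is stated for congruences of varieties, and for every Ω with Ω_{V(Ω)} in place of Ω; the 1:1 correspondence is stated for nonempty varieties, and also with the empty variety and its congruence added. *)

theory Defs
  imports "HOL-Algebra.FiniteProduct"
begin

section \<open>Semirings with unit, not necessarily with zero\<close>

record 'a semiringd = "'a monoid" +
  sadd :: "['a, 'a] \<Rightarrow> 'a" (infixl \<open>\<oplus>\<index>\<close> 65)

locale semiringd = comm_monoid R for R (structure) +
  assumes add_closed: "\<lbrakk>x \<in> carrier R; y \<in> carrier R\<rbrakk> \<Longrightarrow> x \<oplus> y \<in> carrier R"
    and add_assoc: "\<lbrakk>x \<in> carrier R; y \<in> carrier R; z \<in> carrier R\<rbrakk>
          \<Longrightarrow> (x \<oplus> y) \<oplus> z = x \<oplus> (y \<oplus> z)"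
    and add_comm: "\<lbrakk>x \<in> carrier R; y \<in> carrier R\<rbrakk> \<Longrightarrow> x \<oplus> y = y \<oplus> x"
    and distr: "\<lbrakk>x \<in> carrier R; y \<in> carrier R; z \<in> carrier R\<rbrakk>
          \<Longrightarrow> x \<otimes> (y \<oplus> z) = (x \<otimes> y) \<oplus> (x \<otimes> z)"

definition semiringd_congruence ::
    "('a, 'm) semiringd_scheme \<Rightarrow> ('a \<times> 'a) set \<Rightarrow> bool" where
  "semiringd_congruence A \<Omega> \<longleftrightarrow> equiv (carrier A) \<Omega> \<and>
     (\<forall>(f, g) \<in> \<Omega>. \<forall>(f', g') \<in> \<Omega>.
        (f \<oplus>\<^bsub>A\<^esub> f', g \<oplus>\<^bsub>A\<^esub> g') \<in> \<Omega> \<and> (f \<otimes>\<^bsub>A\<^esub> f', g \<otimes>\<^bsub>A\<^esub> g') \<in> \<Omega>)"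

definition semiringd_quot ::
    "('a, 'm) semiringd_scheme \<Rightarrow> ('a \<times> 'a) set \<Rightarrow> 'a set semiringd" where
  "semiringd_quot A \<Omega> = \<lparr>
     carrier = carrier A // \<Omega>,
     mult = (\<lambda>P Q. \<Union>f\<in>P. \<Union>g\<in>Q. \<Omega> `` {f \<otimes>\<^bsub>A\<^esub> g}),
     one = \<Omega> `` {\<one>\<^bsub>A\<^esub>},
     sadd = (\<lambda>P Q. \<Union>f\<in>P. \<Union>g\<in>Q. \<Omega> `` {f \<oplus>\<^bsub>A\<^esub> g}) \<rparr>"

definition semiringd_isomorphic ::
    "('a, 'm) semiringd_scheme \<Rightarrow> ('b, 'k) semiringd_scheme \<Rightarrow> bool" where
  "semiringd_isomorphic A B \<longleftrightarrow> (\<exists>\<phi>. bij_betw \<phi> (carrier A) (carrier B) \<and>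
     \<phi> \<one>\<^bsub>A\<^esub> = \<one>\<^bsub>B\<^esub> \<and>
     (\<forall>x \<in> carrier A. \<forall>y \<in> carrier A.
        \<phi> (x \<otimes>\<^bsub>A\<^esub> y) = \<phi> x \<otimes>\<^bsub>B\<^esub> \<phi> y \<and> \<phi> (x \<oplus>\<^bsub>A\<^esub> y) = \<phi> x \<oplus>\<^bsub>B\<^esub> \<phi> y))"

section \<open>Layered bisemifields\<close>

text \<open>\<open>geq l k\<close> is $l \ge k$. Positivity of the nonzero elements is the condition
  $l + k \ge l$; for $k = 0$ (if a zero is present) it is reflexivity.\<close>

locale sorting_semiring = L: semiringd L for L (structure) +
  fixes geq :: "'l \<Rightarrow> 'l \<Rightarrow> bool"
  assumes geq_refl: "l \<in> carrier L \<Longrightarrow> geq l l"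
    and geq_trans: "\<lbrakk>l \<in> carrier L; k \<in> carrier L; j \<in> carrier L; geq l k; geq k j\<rbrakk> \<Longrightarrow> geq l j"
    and geq_add: "\<lbrakk>l \<in> carrier L; k \<in> carrier L; j \<in> carrier L; geq l k\<rbrakk>
          \<Longrightarrow> geq (l \<oplus> j) (k \<oplus> j)"
    and geq_mult: "\<lbrakk>l \<in> carrier L; k \<in> carrier L; j \<in> carrier L; geq l k\<rbrakk>
          \<Longrightarrow> geq (l \<otimes> j) (k \<otimes> j)"
    and positive: "\<lbrakk>l \<in> carrier L; k \<in> carrier L\<rbrakk> \<Longrightarrow> geq (l \<oplus> k) l"

text \<open>An infinite element is one that absorbs both addition and multiplication; it is
  unique if it exists.\<close>

definition infinite_element :: "('l, 'm) semiringd_scheme \<Rightarrow> 'l \<Rightarrow> bool" where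
  "infinite_element L k \<longleftrightarrow> k \<in> carrier L \<and>
     (\<forall>a \<in> carrier L. k \<oplus>\<^bsub>L\<^esub> a = k \<and> k \<otimes>\<^bsub>L\<^esub> a = k)"

text \<open>\<open>lay l\<close> is the layer $R_l$, and \<open>nu m l\<close> is the sort transition map
  $\nu_{m,l} : R_l \to R_m$, which is meaningful only for $m \ge l$ and on $R_l$.\<close>

definition nu_cong :: "('l, 'm) semiringd_scheme \<Rightarrow> ('l \<Rightarrow> 'l \<Rightarrow> bool) \<Rightarrow>
    ('l \<Rightarrow> 'a set) \<Rightarrow> ('l \<Rightarrow> 'l \<Rightarrow> 'a \<Rightarrow> 'a) \<Rightarrow> 'a \<Rightarrow> 'a \<Rightarrow> bool" where
  "nu_cong L geq lay nu a b \<longleftrightarrow>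
     (\<exists>k \<in> carrier L. \<exists>l \<in> carrier L. \<exists>m \<in> carrier L.
        a \<in> lay k \<and> b \<in> lay l \<and> geq m k \<and> geq m l \<and> nu m k a = nu m l b)"

locale layered_predomain =
  sorting_semiring L geq + R: semiringd R
  for L :: "('l, 'm) semiringd_scheme" and geq :: "'l \<Rightarrow> 'l \<Rightarrow> bool"
    and R :: "('a, 'k) semiringd_scheme" +
  fixes lay :: "'l \<Rightarrow> 'a set"
    and nu :: "'l \<Rightarrow> 'l \<Rightarrow> 'a \<Rightarrow> 'a"
  assumes layers_cover: "(\<Union>l \<in> carrier L. lay l) = carrier R"
    and layers_disjoint: "\<lbrakk>k \<in> carrier L; l \<in> carrier L; k \<noteq> l\<rbrakk> \<Longrightarrow> lay k \<inter> lay l = {}"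
    and nu_maps: "\<lbrakk>m \<in> carrier L; l \<in> carrier L; geq m l\<rbrakk> \<Longrightarrow> nu m l \<in> lay l \<rightarrow> lay m"
    and nu_id: "\<lbrakk>l \<in> carrier L; a \<in> lay l\<rbrakk> \<Longrightarrow> nu l l a = a"
    and nu_comp: "\<lbrakk>m \<in> carrier L; l \<in> carrier L; k \<in> carrier L; geq m l; geq l k; a \<in> lay k\<rbrakk>
          \<Longrightarrow> nu m l (nu l k a) = nu m k a"
    and A1: "\<one>\<^bsub>R\<^esub> \<in> lay \<one>\<^bsub>L\<^esub>"
    and A2: "\<lbrakk>k \<in> carrier L; l \<in> carrier L; a \<in> lay k; b \<in> lay l\<rbrakk>
          \<Longrightarrow> a \<otimes>\<^bsub>R\<^esub> b \<in> lay (k \<otimes>\<^bsub>L\<^esub> l)"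
    and A3: "\<lbrakk>k \<in> carrier L; l \<in> carrier L; m \<in> carrier L; m' \<in> carrier L;
            a \<in> lay k; b \<in> lay l; geq m k; geq m' l\<rbrakk>
          \<Longrightarrow> nu m k a \<otimes>\<^bsub>R\<^esub> nu m' l b = nu (m \<otimes>\<^bsub>L\<^esub> m') (k \<otimes>\<^bsub>L\<^esub> l) (a \<otimes>\<^bsub>R\<^esub> b)"
    and A4: "\<lbrakk>k \<in> carrier L; l \<in> carrier L; l' \<in> carrier L; a \<in> lay k; geq l k; geq l' k\<rbrakk>
          \<Longrightarrow> nu l k a \<oplus>\<^bsub>R\<^esub> nu l' k a = nu (l \<oplus>\<^bsub>L\<^esub> l') k a"
    and B_layer: "\<lbrakk>k \<in> carrier L; l \<in> carrier L; a \<in> lay k; b \<in> lay l; nu_cong L geq lay nu a b\<rbrakk>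
          \<Longrightarrow> a \<oplus>\<^bsub>R\<^esub> b \<in> lay (k \<oplus>\<^bsub>L\<^esub> l)"
    and B_cong: "\<lbrakk>k \<in> carrier L; l \<in> carrier L; a \<in> lay k; b \<in> lay l; nu_cong L geq lay nu a b\<rbrakk>
          \<Longrightarrow> nu_cong L geq lay nu (a \<oplus>\<^bsub>R\<^esub> b) a"
    and B_infinite: "\<lbrakk>infinite_element L k; l \<in> carrier L; a \<in> lay k; b \<in> lay l;
            nu_cong L geq lay nu a b\<rbrakk>
          \<Longrightarrow> a \<oplus>\<^bsub>R\<^esub> b = a"

locale layered_bidomain = layered_predomain L geq R lay nu
  for L :: "('l, 'm) semiringd_scheme" and geq :: "'l \<Rightarrow> 'l \<Rightarrow> bool"
    and R :: "('a, 'k) semiringd_scheme" and lay :: "'l \<Rightarrow> 'a set"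
    and nu :: "'l \<Rightarrow> 'l \<Rightarrow> 'a \<Rightarrow> 'a" +
  assumes nu_bipotent: "\<lbrakk>a \<in> carrier R; b \<in> carrier R\<rbrakk>
          \<Longrightarrow> nu_cong L geq lay nu (a \<oplus>\<^bsub>R\<^esub> b) a \<or> nu_cong L geq lay nu (a \<oplus>\<^bsub>R\<^esub> b) b"
    and cancellative: "\<lbrakk>a \<in> carrier R; b \<in> carrier R; c \<in> carrier R; a \<otimes>\<^bsub>R\<^esub> c = b \<otimes>\<^bsub>R\<^esub> c\<rbrakk>
          \<Longrightarrow> a = b"

locale layered_bisemifield = layered_bidomain L geq R lay nu
  for L :: "('l, 'm) semiringd_scheme" and geq :: "'l \<Rightarrow> 'l \<Rightarrow> bool"
    and R :: "('a, 'k) semiringd_scheme" and lay :: "'l \<Rightarrow> 'a set"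
    and nu :: "'l \<Rightarrow> 'l \<Rightarrow> 'a \<Rightarrow> 'a" +
  assumes unit_layer_group: "comm_group (R\<lparr>carrier := lay \<one>\<^bsub>L\<^esub>\<rparr>)"

section \<open>Functions and polynomial functions\<close>

definition Fun_semiring :: "'p set \<Rightarrow> ('a, 'm) semiringd_scheme \<Rightarrow> ('p \<Rightarrow> 'a) semiringd" where
  "Fun_semiring S F = \<lparr>
     carrier = S \<rightarrow>\<^sub>E carrier F,
     mult = (\<lambda>f g. \<lambda>x\<in>S. f x \<otimes>\<^bsub>F\<^esub> g x),
     one = (\<lambda>x\<in>S. \<one>\<^bsub>F\<^esub>),
     sadd = (\<lambda>f g. \<lambda>x\<in>S. f x \<oplus>\<^bsub>F\<^esub> g x) \<rparr>"

text \<open>Since \<open>F\<close> need not have a zero, sums over a nonempty finite index set are computed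
  in the additive semigroup of \<open>F\<close> with a neutral element \<open>None\<close> adjoined.\<close>

definition add_adjoin_zero :: "('a, 'm) semiringd_scheme \<Rightarrow> 'a option monoid" where
  "add_adjoin_zero F = \<lparr>
     carrier = insert None (Some ` carrier F),
     mult = (\<lambda>x y. case x of None \<Rightarrow> y
       | Some a \<Rightarrow> (case y of None \<Rightarrow> x | Some b \<Rightarrow> Some (a \<oplus>\<^bsub>F\<^esub> b))),
     one = None \<rparr>"

definition semiringd_sum ::
    "('a, 'm) semiringd_scheme \<Rightarrow> ('i \<Rightarrow> 'a) \<Rightarrow> 'i set \<Rightarrow> 'a" where
  "semiringd_sum F f I = the (finprod (add_adjoin_zero F) (\<lambda>i. Some (f i)) I)"

definition affine_space :: "nat \<Rightarrow> ('a, 'm) semiringd_scheme \<Rightarrow> (nat \<Rightarrow> 'a) set" where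
  "affine_space n F = {..<n} \<rightarrow>\<^sub>E carrier F"

text \<open>The elements of $F[\lambda_1,\dots,\lambda_n]$: nonempty finite formal sums of monomials
  with pairwise distinct exponent vectors. A monomial not occurring has no coefficient,
  rather than the coefficient zero.\<close>

definition polynomials ::
    "nat \<Rightarrow> ('a, 'm) semiringd_scheme \<Rightarrow> ((nat \<Rightarrow> nat) \<Rightarrow> 'a option) set" where
  "polynomials n F = {p. finite (dom p) \<and> dom p \<noteq> {} \<and>
     dom p \<subseteq> {..<n} \<rightarrow>\<^sub>E UNIV \<and> ran p \<subseteq> carrier F}"

definition poly_eval ::
    "nat \<Rightarrow> ('a, 'm) semiringd_scheme \<Rightarrow> ((nat \<Rightarrow> nat) \<Rightarrow> 'a option) \<Rightarrow> (nat \<Rightarrow> 'a) \<Rightarrow> 'a" where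
  "poly_eval n F p a =
     semiringd_sum F (\<lambda>e. the (p e) \<otimes>\<^bsub>F\<^esub> finprod F (\<lambda>j. a j [^]\<^bsub>F\<^esub> e j) {..<n}) (dom p)"

definition Pol_semiring ::
    "nat \<Rightarrow> (nat \<Rightarrow> 'a) set \<Rightarrow> ('a, 'm) semiringd_scheme \<Rightarrow> ((nat \<Rightarrow> 'a) \<Rightarrow> 'a) semiringd" where
  "Pol_semiring n S F = (Fun_semiring S F)
     \<lparr>carrier := (\<lambda>p. \<lambda>a\<in>S. poly_eval n F p a) ` polynomials n F\<rparr>"

abbreviation coordinate_semiring ::
    "nat \<Rightarrow> ('a, 'm) semiringd_scheme \<Rightarrow> (nat \<Rightarrow> 'a) set \<Rightarrow> ((nat \<Rightarrow> 'a) \<Rightarrow> 'a) semiringd" where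
  "coordinate_semiring n F X \<equiv> Pol_semiring n X F"

definition Pol_quot ::
    "nat \<Rightarrow> (nat \<Rightarrow> 'a) set \<Rightarrow> ('a, 'm) semiringd_scheme \<Rightarrow>
      (((nat \<Rightarrow> 'a) \<Rightarrow> 'a) \<times> ((nat \<Rightarrow> 'a) \<Rightarrow> 'a)) set \<Rightarrow> ((nat \<Rightarrow> 'a) \<Rightarrow> 'a) set semiringd" where
  "Pol_quot n S F \<Omega> = semiringd_quot (Pol_semiring n S F)
     (\<Omega> \<inter> carrier (Pol_semiring n S F) \<times> carrier (Pol_semiring n S F))"

section \<open>Congruences and varieties\<close>

definition cong_of ::
    "'p set \<Rightarrow> ('a, 'm) semiringd_scheme \<Rightarrow> 'p set \<Rightarrow> (('p \<Rightarrow> 'a) \<times> ('p \<Rightarrow> 'a)) set" where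
  "cong_of S F X = {(f, g). f \<in> carrier (Fun_semiring S F) \<and> g \<in> carrier (Fun_semiring S F) \<and>
     (\<forall>a\<in>X. f a = g a)}"

definition variety :: "'p set \<Rightarrow> (('p \<Rightarrow> 'a) \<times> ('p \<Rightarrow> 'a)) set \<Rightarrow> 'p set" where
  "variety S \<Omega> = {a \<in> S. \<forall>(f, g) \<in> \<Omega>. f a = g a}"

definition congruences_of_varieties ::
    "'p set \<Rightarrow> ('a, 'm) semiringd_scheme \<Rightarrow> (('p \<Rightarrow> 'a) \<times> ('p \<Rightarrow> 'a)) set set" where
  "congruences_of_varieties S F =
     {\<Omega>. semiringd_congruence (Fun_semiring S F) \<Omega> \<and>
       (\<exists>X. X \<subseteq> S \<and> X \<noteq> {} \<and> \<Omega> = cong_of S F X)}"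

definition varieties_of_congruences ::
    "'p set \<Rightarrow> ('a, 'm) semiringd_scheme \<Rightarrow> 'p set set" where
  "varieties_of_congruences S F =
     {Z. \<exists>\<Omega>. semiringd_congruence (Fun_semiring S F) \<Omega> \<and> Z = variety S \<Omega>}"

end

theory Submission
  imports Defs
begin

text \<open>Everything about varieties is formal: \<open>variety S\<close> and \<open>cong_of S F\<close> form an
  antitone Galois connection between relations on the functions and subsets of \<open>S\<close>.
  For the coordinate semiring, restricting functions from \<open>S\<close> to \<open>X\<close> maps the polynomial
  functions on \<open>S\<close> onto those on \<open>X\<close>, with kernel congruence induced by \<open>cong_of S F X\<close>, and
  the first isomorphism theorem applies once sums and products of polynomial functions are
  known to be polynomial. Without a zero, the latter is shown by adding one monomial at
  a time.\<close>

section \<open>The first isomorphism theorem\<close>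

text \<open>The class of \<open>x\<close> under the kernel of \<open>\<rho>\<close> is the fibre of
  \<open>\<rho>\<close> over \<open>\<rho> x\<close>. Hence sending \<open>b\<close> to its fibre
  inverts the map induced by \<open>\<rho>\<close>, and surjectivity makes every fibre a
  class.\<close>

lemma semiringd_quot_isomorphic:
  assumes closed: "\<one>\<^bsub>A\<^esub> \<in> carrier A"
      "\<And>x y. \<lbrakk>x \<in> carrier A; y \<in> carrier A\<rbrakk> \<Longrightarrow> x \<otimes>\<^bsub>A\<^esub> y \<in> carrier A"
      "\<And>x y. \<lbrakk>x \<in> carrier A; y \<in> carrier A\<rbrakk> \<Longrightarrow> x \<oplus>\<^bsub>A\<^esub> y \<in> carrier A"
    and surj: "\<rho> ` carrier A = carrier B"
    and hom: "\<rho> \<one>\<^bsub>A\<^esub> = \<one>\<^bsub>B\<^esub>"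
      "\<And>x y. \<lbrakk>x \<in> carrier A; y \<in> carrier A\<rbrakk> \<Longrightarrow> \<rho> (x \<otimes>\<^bsub>A\<^esub> y) = \<rho> x \<otimes>\<^bsub>B\<^esub> \<rho> y"
      "\<And>x y. \<lbrakk>x \<in> carrier A; y \<in> carrier A\<rbrakk> \<Longrightarrow> \<rho> (x \<oplus>\<^bsub>A\<^esub> y) = \<rho> x \<oplus>\<^bsub>B\<^esub> \<rho> y"
  shows "semiringd_isomorphic B
    (semiringd_quot A {(x, y). x \<in> carrier A \<and> y \<in> carrier A \<and> \<rho> x = \<rho> y})"
proof -
  define K where "K = {(x, y). x \<in> carrier A \<and> y \<in> carrier A \<and> \<rho> x = \<rho> y}"
  define \<phi> where "\<phi> b = {x \<in> carrier A. \<rho> x = b}" for b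
  have class_eq: "K `` {x} = \<phi> (\<rho> x)" if "x \<in> carrier A" for x
    using that by (auto simp: K_def \<phi>_def)
  have inhabited: "\<exists>x \<in> carrier A. \<rho> x = b" if "b \<in> carrier B" for b
    using surj that by (metis imageE)
  have "inj_on \<phi> (carrier B)"
  proof (rule inj_onI)
    fix b c assume "b \<in> carrier B" "c \<in> carrier B" "\<phi> b = \<phi> c"
    moreover obtain x where "x \<in> \<phi> b"
      using inhabited[OF \<open>b \<in> carrier B\<close>] by (auto simp: \<phi>_def)
    ultimately show "b = c"
      by (auto simp: \<phi>_def)
  qed
  moreover have "\<phi> ` carrier B = carrier A // K"
    using class_eq by (auto simp: quotient_def surj[symmetric])
  ultimately have "bij_betw \<phi> (carrier B) (carrier A // K)"
    by (simp add: bij_betw_def)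
  moreover have "\<phi> \<one>\<^bsub>B\<^esub> = K `` {\<one>\<^bsub>A\<^esub>}"
    using class_eq closed(1) hom(1) by simp
  moreover have "\<phi> (b \<otimes>\<^bsub>B\<^esub> c) = (\<Union>x\<in>\<phi> b. \<Union>y\<in>\<phi> c. K `` {x \<otimes>\<^bsub>A\<^esub> y})"
    if "b \<in> carrier B" "c \<in> carrier B" for b c
  proof -
    \<comment> \<open>All members of the double union that defines the product of classes coincide,
      so the union collapses to one class once both fibres are nonempty.\<close>
    have "K `` {x \<otimes>\<^bsub>A\<^esub> y} = \<phi> (b \<otimes>\<^bsub>B\<^esub> c)" if "x \<in> \<phi> b" "y \<in> \<phi> c" for x y
      using that class_eq closed(2) hom(2) by (auto simp: \<phi>_def)
    moreover have "\<phi> b \<noteq> {}" "\<phi> c \<noteq> {}"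
      using inhabited that by (auto simp: \<phi>_def)
    ultimately show ?thesis by simp
  qed
  moreover have "\<phi> (b \<oplus>\<^bsub>B\<^esub> c) = (\<Union>x\<in>\<phi> b. \<Union>y\<in>\<phi> c. K `` {x \<oplus>\<^bsub>A\<^esub> y})"
    if "b \<in> carrier B" "c \<in> carrier B" for b c
  proof -
    have "K `` {x \<oplus>\<^bsub>A\<^esub> y} = \<phi> (b \<oplus>\<^bsub>B\<^esub> c)" if "x \<in> \<phi> b" "y \<in> \<phi> c" for x y
      using that class_eq closed(3) hom(3) by (auto simp: \<phi>_def)
    moreover have "\<phi> b \<noteq> {}" "\<phi> c \<noteq> {}"
      using inhabited that by (auto simp: \<phi>_def)
    ultimately show ?thesis by simp
  qed
  ultimately show ?thesis
    unfolding semiringd_isomorphic_def semiringd_quot_def K_def[symmetric]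
    by (intro exI[of _ \<phi>]) simp
qed

section \<open>Polynomial functions over a semiring without zero\<close>

text \<open>Names the product inside \<open>poly_eval\<close>, so that it can be folded back
  whenever \<open>poly_eval\<close> is unfolded.\<close>

definition monomial_eval :: "nat \<Rightarrow> ('a, 'm) semiringd_scheme \<Rightarrow> (nat \<Rightarrow> nat) \<Rightarrow> (nat \<Rightarrow> 'a) \<Rightarrow> 'a"
  where "monomial_eval n F e a = finprod F (\<lambda>j. a j [^]\<^bsub>F\<^esub> e j) {..<n}"

lemma polynomials_single:
  "\<lbrakk>e \<in> {..<n} \<rightarrow>\<^sub>E UNIV; c \<in> carrier F\<rbrakk> \<Longrightarrow> [e \<mapsto> c] \<in> polynomials n F"
  by (auto simp: polynomials_def)

lemma polynomials_update:
  assumes "p \<in> polynomials n F" "e \<in> {..<n} \<rightarrow>\<^sub>E UNIV" "c \<in> carrier F"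
  shows "p(e \<mapsto> c) \<in> polynomials n F"
  using assms by (auto simp: polynomials_def ran_def split: if_splits)

text \<open>A further exponent must remain, because there is no polynomial without terms.\<close>

lemma polynomials_remove:
  assumes "p \<in> polynomials n F" "dom p - {e} \<noteq> {}"
  shows "p(e := None) \<in> polynomials n F"
proof -
  have "ran (p(e := None)) \<subseteq> ran p"
    by (auto simp: ran_def)
  then show ?thesis
    using assms unfolding polynomials_def mem_Collect_eq dom_fun_upd by auto
qed

text \<open>Induction on the nonempty finite domain: the base case is a single monomial instead of a
  zero polynomial, and each added term has a fresh exponent, so coefficients never merge.\<close>

lemma polynomials_induct [consumes 1, case_names single update]:
  assumes "p \<in> polynomials n F"
    and single: "\<And>e c. \<lbrakk>e \<in> {..<n} \<rightarrow>\<^sub>E UNIV; c \<in> carrier F\<rbrakk> \<Longrightarrow> P [e \<mapsto> c]"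
    and update: "\<And>p e c. \<lbrakk>p \<in> polynomials n F; e \<in> {..<n} \<rightarrow>\<^sub>E UNIV; c \<in> carrier F;
        e \<notin> dom p; P p\<rbrakk> \<Longrightarrow> P (p(e \<mapsto> c))"
  shows "P p"
proof -
  have "finite (dom p)" "dom p \<noteq> {}"
    using assms(1) by (auto simp: polynomials_def)
  then show ?thesis
    using assms(1)
  proof (induction "dom p" arbitrary: p rule: finite_ne_induct)
    case (singleton e)
    then obtain c where p_eq: "p = [e \<mapsto> c]"
      by (metis dom_eq_singleton_conv)
    then have "e \<in> {..<n} \<rightarrow>\<^sub>E UNIV" "c \<in> carrier F"
      using singleton.prems by (auto simp: polynomials_def simp del: fun_upd_apply)
    then show ?case
      unfolding p_eq by (rule single)
  next
    case (insert e D)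
    define q where "q = p(e := None)"
    obtain c where c: "p e = Some c"
      using insert.hyps(5) by auto
    have dom_q: "dom q = D"
      using insert.hyps by (auto simp: q_def)
    have p_eq: "p = q(e \<mapsto> c)"
      using c by (auto simp: q_def)
    have "dom p - {e} = D"
      using insert.hyps(3,5) by blast
    then have q: "q \<in> polynomials n F"
      unfolding q_def using insert.hyps(2) by (intro polynomials_remove[OF insert.prems]) simp
    have "e \<in> {..<n} \<rightarrow>\<^sub>E UNIV" "c \<in> carrier F"
      using insert.prems insert.hyps c by (auto simp: polynomials_def intro: ranI)
    moreover have "P q"
      using insert.hyps(4)[of q] dom_q q by simp
    ultimately show ?case
      using update[OF q] dom_q insert.hyps(3) p_eq by simp
  qed
qed

section \<open>Nonempty finite sums in an additive semigroup\<close>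

lemma add_adjoin_zero_simps:
  "carrier (add_adjoin_zero F) = insert None (Some ` carrier F)"
  "\<one>\<^bsub>add_adjoin_zero F\<^esub> = None"
  "None \<otimes>\<^bsub>add_adjoin_zero F\<^esub> x = x"
  "x \<otimes>\<^bsub>add_adjoin_zero F\<^esub> None = x"
  "Some a \<otimes>\<^bsub>add_adjoin_zero F\<^esub> Some b = Some (a \<oplus>\<^bsub>F\<^esub> b)"
  by (simp_all add: add_adjoin_zero_def split: option.split)

context semiringd
begin

lemma distr_right:
  assumes "x \<in> carrier R" "y \<in> carrier R" "z \<in> carrier R"
  shows "(x \<oplus> y) \<otimes> z = x \<otimes> z \<oplus> y \<otimes> z"
  using assms distr[of z x y] m_comm[of z x] m_comm[of z y] m_comm[of z "x \<oplus> y"]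
  by (simp add: add_closed)

lemma add_adjoin_zero_comm_monoid: "comm_monoid (add_adjoin_zero R)"
proof (rule comm_monoidI)
  fix x y z
  assume "x \<in> carrier (add_adjoin_zero R)" "y \<in> carrier (add_adjoin_zero R)"
    "z \<in> carrier (add_adjoin_zero R)"
  then show "x \<otimes>\<^bsub>add_adjoin_zero R\<^esub> y \<otimes>\<^bsub>add_adjoin_zero R\<^esub> z =
      x \<otimes>\<^bsub>add_adjoin_zero R\<^esub> (y \<otimes>\<^bsub>add_adjoin_zero R\<^esub> z)"
    by (auto simp: add_adjoin_zero_simps add_assoc)
qed (auto simp: add_adjoin_zero_simps add_closed add_comm)

text \<open>A nonempty sum of \<open>Some\<close> values is never the adjoined neutral element
  \<open>None\<close>. So the \<open>the\<close> in \<open>semiringd_sum\<close> recovers a genuine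
  element, and laws of \<open>finprod\<close> transfer to \<open>semiringd_sum\<close>.\<close>

lemma semiringd_sum_Some:
  assumes "finite I" "I \<noteq> {}" "f \<in> I \<rightarrow> carrier R"
  shows "semiringd_sum R f I \<in> carrier R"
    and "finprod (add_adjoin_zero R) (\<lambda>i. Some (f i)) I = Some (semiringd_sum R f I)"
proof -
  interpret T: comm_monoid "add_adjoin_zero R"
    by (rule add_adjoin_zero_comm_monoid)
  have "\<exists>s \<in> carrier R. finprod (add_adjoin_zero R) (\<lambda>i. Some (f i)) I = Some s"
    using assms
  proof (induction I rule: finite_ne_induct)
    case (singleton i)
    then show ?case
      by (subst T.finprod_insert) (auto simp: add_adjoin_zero_simps)
  next
    case (insert i I)
    have "finprod (add_adjoin_zero R) (\<lambda>i. Some (f i)) (insert i I) =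
        Some (f i) \<otimes>\<^bsub>add_adjoin_zero R\<^esub> finprod (add_adjoin_zero R) (\<lambda>i. Some (f i)) I"
      using insert by (intro T.finprod_insert) (auto simp: add_adjoin_zero_simps)
    moreover obtain s where "s \<in> carrier R"
        "finprod (add_adjoin_zero R) (\<lambda>i. Some (f i)) I = Some s"
      using insert by auto
    ultimately show ?case
      using insert.prems by (auto simp: add_adjoin_zero_simps add_closed)
  qed
  then show "semiringd_sum R f I \<in> carrier R"
    "finprod (add_adjoin_zero R) (\<lambda>i. Some (f i)) I = Some (semiringd_sum R f I)"
    by (auto simp: semiringd_sum_def)
qed

lemma semiringd_sum_singleton:
  assumes "f i \<in> carrier R"
  shows "semiringd_sum R f {i} = f i"
proof -
  interpret T: comm_monoid "add_adjoin_zero R"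
    by (rule add_adjoin_zero_comm_monoid)
  show ?thesis
    unfolding semiringd_sum_def using assms
    by (subst T.finprod_insert) (auto simp: add_adjoin_zero_simps)
qed

lemma semiringd_sum_insert:
  assumes "finite I" "I \<noteq> {}" "i \<notin> I" "f \<in> insert i I \<rightarrow> carrier R"
  shows "semiringd_sum R f (insert i I) = f i \<oplus> semiringd_sum R f I"
proof -
  interpret T: comm_monoid "add_adjoin_zero R"
    by (rule add_adjoin_zero_comm_monoid)
  have "finprod (add_adjoin_zero R) (\<lambda>i. Some (f i)) (insert i I) =
      Some (f i) \<otimes>\<^bsub>add_adjoin_zero R\<^esub> finprod (add_adjoin_zero R) (\<lambda>i. Some (f i)) I"
    using assms by (intro T.finprod_insert) (auto simp: add_adjoin_zero_simps)
  also have "\<dots> = Some (f i) \<otimes>\<^bsub>add_adjoin_zero R\<^esub> Some (semiringd_sum R f I)"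
    using assms by (subst semiringd_sum_Some(2)) auto
  finally show ?thesis
    by (simp add: semiringd_sum_def add_adjoin_zero_simps)
qed

lemma semiringd_sum_cong:
  assumes "finite I" "I \<noteq> {}" "g \<in> I \<rightarrow> carrier R" "\<And>i. i \<in> I \<Longrightarrow> f i = g i"
  shows "semiringd_sum R f I = semiringd_sum R g I"
proof -
  interpret T: comm_monoid "add_adjoin_zero R"
    by (rule add_adjoin_zero_comm_monoid)
  have "finprod (add_adjoin_zero R) (\<lambda>i. Some (f i)) I =
      finprod (add_adjoin_zero R) (\<lambda>i. Some (g i)) I"
    using assms by (intro T.finprod_cong') (auto simp: add_adjoin_zero_simps)
  then show ?thesis
    by (simp add: semiringd_sum_def)
qed

section \<open>Evaluation of monomials and polynomials\<close>

lemma monomial_eval_closed: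
  "a \<in> affine_space n R \<Longrightarrow> monomial_eval n R e a \<in> carrier R"
  unfolding monomial_eval_def by (auto simp: affine_space_def intro!: finprod_closed)

text \<open>Powers of each coordinate combine factor by factor. The exponent sum is restricted to
  \<open>{..<n}\<close> so that it is again an admissible, extensional exponent vector.\<close>

lemma monomial_eval_mult:
  assumes "a \<in> affine_space n R"
  shows "monomial_eval n R d a \<otimes> monomial_eval n R e a =
    monomial_eval n R (\<lambda>j\<in>{..<n}. d j + e j) a"
proof -
  have a: "a j \<in> carrier R" if "j < n" for j
    using assms that by (auto simp: affine_space_def)
  then have "monomial_eval n R d a \<otimes> monomial_eval n R e a =
      finprod R (\<lambda>j. a j [^] d j \<otimes> a j [^] e j) {..<n}"
    unfolding monomial_eval_def by (subst finprod_multf) auto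
  also have "\<dots> = monomial_eval n R (\<lambda>j\<in>{..<n}. d j + e j) a"
    unfolding monomial_eval_def using a
    by (intro finprod_cong') (auto simp: nat_pow_mult)
  finally show ?thesis .
qed

lemma poly_eval_single:
  assumes "c \<in> carrier R" "a \<in> affine_space n R"
  shows "poly_eval n R [e \<mapsto> c] a = c \<otimes> monomial_eval n R e a"
  using assms monomial_eval_closed[OF assms(2)]
  by (simp add: poly_eval_def semiringd_sum_singleton flip: monomial_eval_def)

lemma polynomial_terms_closed:
  assumes "p \<in> polynomials n R" "a \<in> affine_space n R"
  shows "(\<lambda>e. the (p e) \<otimes> monomial_eval n R e a) \<in> dom p \<rightarrow> carrier R"
proof
  fix e assume "e \<in> dom p"
  then have "the (p e) \<in> carrier R"
    using assms(1) by (force simp: polynomials_def intro: ranI)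
  then show "the (p e) \<otimes> monomial_eval n R e a \<in> carrier R"
    using monomial_eval_closed[OF assms(2)] by simp
qed

lemma poly_eval_closed:
  assumes "p \<in> polynomials n R" "a \<in> affine_space n R"
  shows "poly_eval n R p a \<in> carrier R"
  unfolding poly_eval_def monomial_eval_def[symmetric]
  using assms polynomial_terms_closed[OF assms]
  by (intro semiringd_sum_Some(1)) (auto simp: polynomials_def)

lemma poly_eval_update:
  assumes p: "p \<in> polynomials n R" and e: "e \<in> {..<n} \<rightarrow>\<^sub>E UNIV" "e \<notin> dom p"
    and c: "c \<in> carrier R" and a: "a \<in> affine_space n R"
  shows "poly_eval n R (p(e \<mapsto> c)) a = c \<otimes> monomial_eval n R e a \<oplus> poly_eval n R p a"
proof -
  let ?t = "\<lambda>p e. the (p e) \<otimes> monomial_eval n R e a"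
  have "?t (p(e \<mapsto> c)) \<in> insert e (dom p) \<rightarrow> carrier R"
    using polynomial_terms_closed[OF polynomials_update[OF p e(1) c] a] by simp
  then have "poly_eval n R (p(e \<mapsto> c)) a =
      c \<otimes> monomial_eval n R e a \<oplus> semiringd_sum R (?t (p(e \<mapsto> c))) (dom p)"
    unfolding poly_eval_def monomial_eval_def[symmetric] using p e
    by (simp add: polynomials_def semiringd_sum_insert)
  \<comment> \<open>As \<open>e\<close> is fresh, the update changes no coefficient on
    \<open>dom p\<close>.\<close>
  also have "semiringd_sum R (?t (p(e \<mapsto> c))) (dom p) = semiringd_sum R (?t p) (dom p)"
    using p e polynomial_terms_closed[OF p a]
    by (intro semiringd_sum_cong) (auto simp: polynomials_def)
  also have "semiringd_sum R (?t p) (dom p) = poly_eval n R p a"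
    by (simp add: poly_eval_def monomial_eval_def)
  finally show ?thesis .
qed

section \<open>Closure of polynomial functions under sums and products\<close>

text \<open>A fresh exponent is simply adjoined. For an exponent already present, the two
  coefficients are added, and distributivity gives the value: the old term is taken out and put back
  with the new coefficient.\<close>

lemma poly_add_monomial:
  assumes p: "p \<in> polynomials n R" and e: "e \<in> {..<n} \<rightarrow>\<^sub>E UNIV" and c: "c \<in> carrier R"
  shows "\<exists>q \<in> polynomials n R. \<forall>a \<in> affine_space n R.
    poly_eval n R q a = c \<otimes> monomial_eval n R e a \<oplus> poly_eval n R p a"
proof (cases "e \<in> dom p")
  case False
  then show ?thesis
    using poly_eval_update[OF p e False c] polynomials_update[OF p e c] by blast
next
  case True
  then obtain d where d: "p e = Some d" by blast
  have d_closed: "d \<in> carrier R"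
    using p d by (auto simp: polynomials_def intro: ranI)
  have cd_closed: "c \<oplus> d \<in> carrier R"
    using c d_closed by (rule add_closed)
  show ?thesis
  proof (cases "dom p = {e}")
    \<comment> \<open>Taking out the only term would leave no polynomial, so this case is computed
      directly.\<close>
    case True
    then obtain d' where "p = [e \<mapsto> d']"
      by (auto simp: dom_eq_singleton_conv)
    with d have "p = [e \<mapsto> d]"
      by simp
    then show ?thesis
      using polynomials_single[OF e cd_closed] c d_closed cd_closed
      by (intro bexI[of _ "[e \<mapsto> c \<oplus> d]"])
        (simp_all add: poly_eval_single distr_right monomial_eval_closed)
  next
    case False
    define q where "q = p(e := None)"
    have q: "q \<in> polynomials n R"
      unfolding q_def using False True by (intro polynomials_remove[OF p]) auto
    have "e \<notin> dom q" and p_eq: "p = q(e \<mapsto> d)"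
      using d by (auto simp: q_def)
    show ?thesis
    proof (intro bexI ballI)
      show "q(e \<mapsto> c \<oplus> d) \<in> polynomials n R"
        using q e cd_closed by (rule polynomials_update)
      fix a assume a: "a \<in> affine_space n R"
      let ?m = "monomial_eval n R e a"
      have m: "?m \<in> carrier R"
        using a by (rule monomial_eval_closed)
      have "poly_eval n R (q(e \<mapsto> c \<oplus> d)) a = (c \<otimes> ?m \<oplus> d \<otimes> ?m) \<oplus> poly_eval n R q a"
        using poly_eval_update[OF q e \<open>e \<notin> dom q\<close> cd_closed a] distr_right[OF c d_closed m] by simp
      also have "\<dots> = c \<otimes> ?m \<oplus> poly_eval n R p a"
        using poly_eval_update[OF q e \<open>e \<notin> dom q\<close> d_closed a] p_eq
          c d_closed m poly_eval_closed[OF q a] by (simp add: add_assoc)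
      finally show "poly_eval n R (q(e \<mapsto> c \<oplus> d)) a = c \<otimes> ?m \<oplus> poly_eval n R p a" .
    qed
  qed
qed

text \<open>The terms of \<open>p\<close> are added to \<open>q\<close> one at a time by
  \<open>poly_add_monomial\<close>.\<close>

lemma poly_add:
  assumes "p \<in> polynomials n R" "q \<in> polynomials n R"
  shows "\<exists>r \<in> polynomials n R. \<forall>a \<in> affine_space n R.
    poly_eval n R r a = poly_eval n R p a \<oplus> poly_eval n R q a"
  using assms
proof (induction p rule: polynomials_induct)
  case (single e c)
  then show ?case
    using poly_add_monomial[of q n e c] by (simp add: poly_eval_single del: fun_upd_apply)
next
  case (update p e c)
  then obtain r where r: "r \<in> polynomials n R"
    "\<And>a. a \<in> affine_space n R \<Longrightarrow> poly_eval n R r a = poly_eval n R p a \<oplus> poly_eval n R q a"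
    by blast
  obtain s where s: "s \<in> polynomials n R" "\<And>a. a \<in> affine_space n R \<Longrightarrow>
      poly_eval n R s a = c \<otimes> monomial_eval n R e a \<oplus> poly_eval n R r a"
    using poly_add_monomial[OF r(1) update(2,3)] by blast
  have "poly_eval n R s a = poly_eval n R (p(e \<mapsto> c)) a \<oplus> poly_eval n R q a"
    if "a \<in> affine_space n R" for a
    using that update s(2) r(2)
    by (simp add: poly_eval_update poly_eval_closed monomial_eval_closed add_assoc)
  then show ?case
    using s(1) by blast
qed

text \<open>Multiplication by a monomial shifts exponents and scales coefficients. The shifted terms
  are collected one by one with \<open>poly_add_monomial\<close>, in place of reindexing a
  sum.\<close>

lemma poly_mult_monomial:
  assumes "p \<in> polynomials n R" and e: "e \<in> {..<n} \<rightarrow>\<^sub>E UNIV" and c: "c \<in> carrier R"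
  shows "\<exists>q \<in> polynomials n R. \<forall>a \<in> affine_space n R.
    poly_eval n R q a = c \<otimes> monomial_eval n R e a \<otimes> poly_eval n R p a"
proof -
  have shift: "c \<otimes> monomial_eval n R e a \<otimes> (d \<otimes> monomial_eval n R e' a) =
      (c \<otimes> d) \<otimes> monomial_eval n R (\<lambda>j\<in>{..<n}. e j + e' j) a"
    if "a \<in> affine_space n R" "d \<in> carrier R" for a d e'
    using that c by (simp add: m_ac monomial_eval_closed flip: monomial_eval_mult)
  show ?thesis
    using assms(1)
  proof (induction p rule: polynomials_induct)
    case (single e' d)
    then show ?case
      using c shift
      by (intro bexI[of _ "[\<lambda>j\<in>{..<n}. e j + e' j \<mapsto> c \<otimes> d]"])
        (auto simp: poly_eval_single simp del: fun_upd_apply intro!: polynomials_single)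
  next
    case (update p e' d)
    then obtain q where q: "q \<in> polynomials n R" "\<And>a. a \<in> affine_space n R \<Longrightarrow>
        poly_eval n R q a = c \<otimes> monomial_eval n R e a \<otimes> poly_eval n R p a"
      by blast
    have "(\<lambda>j\<in>{..<n}. e j + e' j) \<in> {..<n} \<rightarrow>\<^sub>E UNIV" "c \<otimes> d \<in> carrier R"
      using c update by auto
    from poly_add_monomial[OF q(1) this]
    obtain r where r: "r \<in> polynomials n R" "\<And>a. a \<in> affine_space n R \<Longrightarrow> poly_eval n R r a =
        c \<otimes> d \<otimes> monomial_eval n R (\<lambda>j\<in>{..<n}. e j + e' j) a \<oplus> poly_eval n R q a"
      by blast
    have "poly_eval n R r a = c \<otimes> monomial_eval n R e a \<otimes> poly_eval n R (p(e' \<mapsto> d)) a"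
      if "a \<in> affine_space n R" for a
      using that c update q(2) r(2)
      by (simp add: poly_eval_update poly_eval_closed monomial_eval_closed distr shift)
    then show ?case
      using r(1) by blast
  qed
qed

text \<open>The product is distributed over the terms of \<open>p\<close>: below, \<open>s\<close>
  represents the new monomial times \<open>q\<close>, \<open>r\<close> the product already built,
  and \<open>t\<close> their sum.\<close>

lemma poly_mult:
  assumes "p \<in> polynomials n R" "q \<in> polynomials n R"
  shows "\<exists>r \<in> polynomials n R. \<forall>a \<in> affine_space n R.
    poly_eval n R r a = poly_eval n R p a \<otimes> poly_eval n R q a"
  using assms
proof (induction p rule: polynomials_induct)
  case (single e c)
  then show ?case
    using poly_mult_monomial[of q n e c] by (simp add: poly_eval_single del: fun_upd_apply)
next
  case (update p e c)
  then obtain r where r: "r \<in> polynomials n R"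
    "\<And>a. a \<in> affine_space n R \<Longrightarrow> poly_eval n R r a = poly_eval n R p a \<otimes> poly_eval n R q a"
    by blast
  obtain s where s: "s \<in> polynomials n R" "\<And>a. a \<in> affine_space n R \<Longrightarrow>
      poly_eval n R s a = c \<otimes> monomial_eval n R e a \<otimes> poly_eval n R q a"
    using poly_mult_monomial[OF update.prems update(2,3)] by blast
  obtain t where t: "t \<in> polynomials n R"
    "\<And>a. a \<in> affine_space n R \<Longrightarrow> poly_eval n R t a = poly_eval n R s a \<oplus> poly_eval n R r a"
    using poly_add[OF s(1) r(1)] by blast
  have "poly_eval n R t a = poly_eval n R (p(e \<mapsto> c)) a \<otimes> poly_eval n R q a"
    if a: "a \<in> affine_space n R" for a
  proof -
    let ?m = "c \<otimes> monomial_eval n R e a"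
    have "?m \<in> carrier R" "poly_eval n R p a \<in> carrier R" "poly_eval n R q a \<in> carrier R"
      using a update by (simp_all add: monomial_eval_closed poly_eval_closed)
    from distr_right[OF this] show ?thesis
      using a update s(2) r(2) t(2) by (simp add: poly_eval_update)
  qed
  then show ?case
    using t(1) by blast
qed

lemma poly_one:
  "\<exists>p \<in> polynomials n R. \<forall>a \<in> affine_space n R. poly_eval n R p a = \<one>"
proof (intro bexI ballI)
  \<comment> \<open>The constant polynomial: coefficient one at the zero exponent vector.\<close>
  let ?p = "[\<lambda>j\<in>{..<n}. 0 \<mapsto> \<one>]"
  show "?p \<in> polynomials n R"
    by (rule polynomials_single) auto
  fix a assume a: "a \<in> affine_space n R"
  have "monomial_eval n R (\<lambda>j\<in>{..<n}. 0) a = \<one>"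
    unfolding monomial_eval_def by (rule finprod_one_eqI) auto
  then show "poly_eval n R ?p a = \<one>"
    using a by (simp add: poly_eval_single)
qed

section \<open>Semirings of polynomial functions and congruences of point sets\<close>

lemma Pol_semiring_closed:
  assumes S: "S \<subseteq> affine_space n R"
  defines "A \<equiv> Pol_semiring n S R"
  shows "\<one>\<^bsub>A\<^esub> \<in> carrier A"
    and "\<lbrakk>f \<in> carrier A; g \<in> carrier A\<rbrakk> \<Longrightarrow> f \<otimes>\<^bsub>A\<^esub> g \<in> carrier A"
    and "\<lbrakk>f \<in> carrier A; g \<in> carrier A\<rbrakk> \<Longrightarrow> f \<oplus>\<^bsub>A\<^esub> g \<in> carrier A"
    and "carrier A \<subseteq> carrier (Fun_semiring S R)"
proof -
  \<comment> \<open>The closure lemmas give identities on the whole affine space; restricting them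
    to \<open>S\<close> turns each into membership in the carrier.\<close>
  have mem: "(\<lambda>a\<in>S. h a) \<in> carrier A"
    if "\<exists>r \<in> polynomials n R. \<forall>a \<in> affine_space n R. poly_eval n R r a = h a" for h
  proof -
    obtain r where "r \<in> polynomials n R" "\<forall>a \<in> affine_space n R. poly_eval n R r a = h a"
      using \<open>\<exists>r \<in> polynomials n R. _ r\<close> by blast
    moreover from this have "(\<lambda>a\<in>S. h a) = (\<lambda>a\<in>S. poly_eval n R r a)"
      using S by (auto intro!: restrict_ext)
    ultimately show ?thesis
      by (auto simp: A_def Pol_semiring_def)
  qed
  show "\<one>\<^bsub>A\<^esub> \<in> carrier A"
    using mem[OF poly_one] by (simp add: A_def Pol_semiring_def Fun_semiring_def)
  show "f \<otimes>\<^bsub>A\<^esub> g \<in> carrier A" "f \<oplus>\<^bsub>A\<^esub> g \<in> carrier A"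
    if fg: "f \<in> carrier A" "g \<in> carrier A"
  proof -
    obtain p q where pq: "p \<in> polynomials n R" "q \<in> polynomials n R"
        "f = (\<lambda>a\<in>S. poly_eval n R p a)" "g = (\<lambda>a\<in>S. poly_eval n R q a)"
      using fg by (auto simp: A_def Pol_semiring_def)
    have "f \<otimes>\<^bsub>A\<^esub> g = (\<lambda>a\<in>S. poly_eval n R p a \<otimes> poly_eval n R q a)"
      "f \<oplus>\<^bsub>A\<^esub> g = (\<lambda>a\<in>S. poly_eval n R p a \<oplus> poly_eval n R q a)"
      by (auto simp: A_def Pol_semiring_def Fun_semiring_def pq intro!: restrict_ext)
    then show "f \<otimes>\<^bsub>A\<^esub> g \<in> carrier A" "f \<oplus>\<^bsub>A\<^esub> g \<in> carrier A"
      using mem[OF poly_mult[OF pq(1,2)]] mem[OF poly_add[OF pq(1,2)]] by simp_all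
  qed
  show "carrier A \<subseteq> carrier (Fun_semiring S R)"
    using S by (auto simp: A_def Pol_semiring_def Fun_semiring_def intro!: poly_eval_closed)
qed

theorem coordinate_semiring_isomorphic:
  assumes S: "S \<subseteq> affine_space n R" and X: "X \<subseteq> S"
  shows "semiringd_isomorphic (coordinate_semiring n R X) (Pol_quot n S R (cong_of S R X))"
proof -
  let ?A = "Pol_semiring n S R" and ?B = "Pol_semiring n X R"
  let ?\<rho> = "\<lambda>f. restrict f X"
  \<comment> \<open>One and the same polynomial represents a function on \<open>S\<close> and its
    restriction to \<open>X\<close>, which yields surjectivity.\<close>
  have "?\<rho> (\<lambda>a\<in>S. h a) = (\<lambda>a\<in>X. h a)" for h :: "(nat \<Rightarrow> 'a) \<Rightarrow> 'a"
    using X by (auto simp: restrict_def fun_eq_iff)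
  then have surj: "?\<rho> ` carrier ?A = carrier ?B"
    by (simp add: Pol_semiring_def image_image)
  have "?\<rho> \<one>\<^bsub>?A\<^esub> = \<one>\<^bsub>?B\<^esub>" "?\<rho> (f \<otimes>\<^bsub>?A\<^esub> g) = ?\<rho> f \<otimes>\<^bsub>?B\<^esub> ?\<rho> g"
    "?\<rho> (f \<oplus>\<^bsub>?A\<^esub> g) = ?\<rho> f \<oplus>\<^bsub>?B\<^esub> ?\<rho> g" for f g
    using X by (auto simp: Pol_semiring_def Fun_semiring_def restrict_def fun_eq_iff)
  then have "semiringd_isomorphic ?B
      (semiringd_quot ?A {(f, g). f \<in> carrier ?A \<and> g \<in> carrier ?A \<and> ?\<rho> f = ?\<rho> g})"
    using Pol_semiring_closed(1-3)[OF S] surj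
    by (intro semiringd_quot_isomorphic) auto
  \<comment> \<open>Restrictions agree exactly when the functions agree at every point of
    \<open>X\<close>; polynomial functions lie in the full function semiring, as
    \<open>cong_of\<close> demands.\<close>
  also have "{(f, g). f \<in> carrier ?A \<and> g \<in> carrier ?A \<and> ?\<rho> f = ?\<rho> g} =
      cong_of S R X \<inter> carrier ?A \<times> carrier ?A"
    using Pol_semiring_closed(4)[OF S] by (auto simp: cong_of_def restrict_def fun_eq_iff)
  finally show ?thesis
    by (simp add: Pol_quot_def)
qed

text \<open>Operations are pointwise, so agreement on \<open>X\<close> is preserved. The case of
  empty \<open>X\<close> is included; it gives the total relation.\<close>

lemma semiringd_congruence_cong_of:
  assumes "X \<subseteq> S"
  shows "semiringd_congruence (Fun_semiring S R) (cong_of S R X)"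
  unfolding semiringd_congruence_def
proof
  show "equiv (carrier (Fun_semiring S R)) (cong_of S R X)"
    by (auto simp: cong_of_def equiv_def refl_on_def sym_def trans_def)
  show "\<forall>(f, g)\<in>cong_of S R X. \<forall>(f', g')\<in>cong_of S R X.
      (f \<oplus>\<^bsub>Fun_semiring S R\<^esub> f', g \<oplus>\<^bsub>Fun_semiring S R\<^esub> g') \<in> cong_of S R X \<and>
      (f \<otimes>\<^bsub>Fun_semiring S R\<^esub> f', g \<otimes>\<^bsub>Fun_semiring S R\<^esub> g') \<in> cong_of S R X"
    using assms by (auto simp: cong_of_def Fun_semiring_def PiE_mem intro!: add_closed)
qed

end

section \<open>The Galois connection\<close>

lemma variety_antimono: "\<Omega>\<^sub>2 \<subseteq> \<Omega>\<^sub>1 \<Longrightarrow> variety S \<Omega>\<^sub>1 \<subseteq> variety S \<Omega>\<^sub>2"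
  by (auto simp: variety_def)

lemma cong_of_antimono: "X \<subseteq> Y \<Longrightarrow> cong_of S F Y \<subseteq> cong_of S F X"
  by (auto simp: cong_of_def)

lemma subset_variety_cong_of: "X \<subseteq> S \<Longrightarrow> X \<subseteq> variety S (cong_of S F X)"
  by (auto simp: variety_def cong_of_def)

text \<open>Pairs in \<open>\<Omega>\<close> agree on its variety by definition; that
  \<open>\<Omega>\<close> is a congruence supplies that both components lie in the function
  semiring.\<close>

lemma subset_cong_of_variety:
  "semiringd_congruence (Fun_semiring S F) \<Omega> \<Longrightarrow> \<Omega> \<subseteq> cong_of S F (variety S \<Omega>)"
  by (auto simp: variety_def cong_of_def semiringd_congruence_def equiv_def refl_on_def)

lemma variety_subset: "variety S \<Omega> \<subseteq> S"
  by (auto simp: variety_def)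

text \<open>The usual Galois argument: one inclusion is antitonicity applied to
  \<open>subset_cong_of_variety\<close>, the other is \<open>subset_variety_cong_of\<close> at the
  variety itself.\<close>

lemma variety_cong_of_variety:
  assumes "semiringd_congruence (Fun_semiring S F) \<Omega>"
  shows "variety S (cong_of S F (variety S \<Omega>)) = variety S \<Omega>"
  by (intro equalityI variety_antimono subset_cong_of_variety[OF assms]
      subset_variety_cong_of variety_subset)

text \<open>The dual argument; \<open>semiringd_congruence_cong_of\<close> allows
  \<open>subset_cong_of_variety\<close> to be applied to the congruence of \<open>X\<close>.\<close>

lemma (in semiringd) cong_of_variety_cong_of:
  assumes "X \<subseteq> S"
  shows "cong_of S R (variety S (cong_of S R X)) = cong_of S R X"
  by (intro equalityI cong_of_antimono subset_variety_cong_of[OF assms]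
      subset_cong_of_variety semiringd_congruence_cong_of assms)

text \<open>A variety may be empty, whereas \<open>congruences_of_varieties\<close> is built from
  nonempty sets; hence the correspondence appears once without the empty set and once with
  \<open>cong_of S F {}\<close> adjoined. The coordinate semiring is compared with the quotient by
  the closure \<open>cong_of S F (variety S \<Omega>)\<close>, since \<open>\<Omega>\<close> itself
  may be too small: if \<open>S\<close> is a point and \<open>\<Omega>\<close> is neither equality
  nor total, the variety is empty and has a one-element coordinate semiring, but the quotient by
  \<open>\<Omega>\<close> has several elements. For congruences of varieties the closure is
  \<open>\<Omega>\<close>.\<close>

theorem proposition9p8:
  fixes L :: "('l, 'm) semiringd_scheme" and geq :: "'l \<Rightarrow> 'l \<Rightarrow> bool"
    and F :: "('a, 'k) semiringd_scheme" and lay :: "'l \<Rightarrow> 'a set"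
    and nu :: "'l \<Rightarrow> 'l \<Rightarrow> 'a \<Rightarrow> 'a"
    and n :: nat and S :: "(nat \<Rightarrow> 'a) set"
  assumes "layered_bisemifield L geq F lay nu"
    and "S \<subseteq> affine_space n F"
  shows
    "(\<forall>\<Omega>\<^sub>1 \<Omega>\<^sub>2. semiringd_congruence (Fun_semiring S F) \<Omega>\<^sub>1 \<longrightarrow>
        semiringd_congruence (Fun_semiring S F) \<Omega>\<^sub>2 \<longrightarrow>
        \<Omega>\<^sub>2 \<subseteq> \<Omega>\<^sub>1 \<longrightarrow> variety S \<Omega>\<^sub>1 \<subseteq> variety S \<Omega>\<^sub>2) \<and>
     (\<forall>X Y. X \<subseteq> S \<longrightarrow> Y \<subseteq> S \<longrightarrow> X \<noteq> {} \<longrightarrow> Y \<noteq> {} \<longrightarrow>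
        X \<subseteq> Y \<longrightarrow> cong_of S F Y \<subseteq> cong_of S F X) \<and>
     (\<forall>\<Omega>. semiringd_congruence (Fun_semiring S F) \<Omega> \<longrightarrow>
        variety S (cong_of S F (variety S \<Omega>)) = variety S \<Omega>) \<and>
     (\<forall>X. X \<subseteq> S \<longrightarrow> X \<noteq> {} \<longrightarrow>
        cong_of S F (variety S (cong_of S F X)) = cong_of S F X) \<and>
     \<comment> \<open>the correspondence, for nonempty sets\<close>
     (bij_betw (cong_of S F) (varieties_of_congruences S F - {{}}) (congruences_of_varieties S F) \<and>
      bij_betw (variety S) (congruences_of_varieties S F) (varieties_of_congruences S F - {{}}) \<and>
      (\<forall>Z \<in> varieties_of_congruences S F - {{}}. variety S (cong_of S F Z) = Z) \<and>
      (\<forall>\<Omega> \<in> congruences_of_varieties S F. cong_of S F (variety S \<Omega>) = \<Omega>)) \<and>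
     \<comment> \<open>the correspondence, with the empty variety and its congruence admitted\<close>
     (bij_betw (cong_of S F) (varieties_of_congruences S F)
        (insert (cong_of S F {}) (congruences_of_varieties S F)) \<and>
      bij_betw (variety S) (insert (cong_of S F {}) (congruences_of_varieties S F))
        (varieties_of_congruences S F) \<and>
      (\<forall>Z \<in> varieties_of_congruences S F. variety S (cong_of S F Z) = Z) \<and>
      (\<forall>\<Omega> \<in> insert (cong_of S F {}) (congruences_of_varieties S F).
         cong_of S F (variety S \<Omega>) = \<Omega>)) \<and>
     (\<forall>\<Omega>. semiringd_congruence (Fun_semiring S F) \<Omega> \<longrightarrow>
        semiringd_isomorphic (coordinate_semiring n F (variety S \<Omega>))
          (Pol_quot n S F (cong_of S F (variety S \<Omega>)))) \<and>
     (\<forall>\<Omega> \<in> congruences_of_varieties S F.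
        semiringd_isomorphic (coordinate_semiring n F (variety S \<Omega>)) (Pol_quot n S F \<Omega>))"
proof -
  interpret layered_bisemifield L geq F lay nu
    by (rule assms(1))
  let ?V = "varieties_of_congruences S F" and ?C = "congruences_of_varieties S F"
  have V: "Z \<subseteq> S" "variety S (cong_of S F Z) = Z" if "Z \<in> ?V" for Z
    using that variety_subset[of S]
    by (auto simp: varieties_of_congruences_def variety_cong_of_variety)
  have C: "cong_of S F (variety S \<Omega>) = \<Omega>" if "\<Omega> \<in> insert (cong_of S F {}) ?C" for \<Omega>
    using that R.cong_of_variety_cong_of by (auto simp: congruences_of_varieties_def)
  have V_to_C: "cong_of S F Z \<in> ?C" if "Z \<in> ?V - {{}}" for Z
    using that V(1)[of Z] R.semiringd_congruence_cong_of[of Z S]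
    by (auto simp: congruences_of_varieties_def)
  have C_to_V: "variety S \<Omega> \<in> ?V - {{}}" if \<Omega>: "\<Omega> \<in> ?C" for \<Omega>
  proof -
    obtain X where "semiringd_congruence (Fun_semiring S F) \<Omega>" "X \<subseteq> S" "X \<noteq> {}"
        "\<Omega> = cong_of S F X"
      using \<Omega> by (auto simp: congruences_of_varieties_def)
    \<comment> \<open>The variety contains the nonempty set \<open>X\<close> that defines
      \<open>\<Omega>\<close>.\<close>
    moreover from this have "variety S \<Omega> \<noteq> {}"
      using subset_variety_cong_of[of X S F] by blast
    ultimately show ?thesis
      unfolding varieties_of_congruences_def by blast
  qed
  have empty_to_V: "variety S (cong_of S F {}) \<in> ?V"
    using R.semiringd_congruence_cong_of[of "{}" S] by (auto simp: varieties_of_congruences_def)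
  \<comment> \<open>An empty \<open>Z\<close> goes to the adjoined congruence; other cases reduce to
    \<open>V_to_C\<close>.\<close>
  have V_to_C': "cong_of S F Z \<in> insert (cong_of S F {}) ?C" if "Z \<in> ?V" for Z
    using that V_to_C[of Z] by blast
  have C_to_V': "variety S \<Omega> \<in> ?V" if "\<Omega> \<in> insert (cong_of S F {}) ?C" for \<Omega>
    using that C_to_V[of \<Omega>] empty_to_V by blast
  have "bij_betw (cong_of S F) (?V - {{}}) ?C"
    by (intro bij_betwI[where g = "variety S"] Pi_I V_to_C C_to_V V(2) C; blast)
  moreover have "bij_betw (variety S) ?C (?V - {{}})"
    by (intro bij_betwI[where g = "cong_of S F"] Pi_I V_to_C C_to_V V(2) C; blast)
  moreover have "bij_betw (cong_of S F) ?V (insert (cong_of S F {}) ?C)"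
    by (intro bij_betwI[where g = "variety S"] Pi_I V_to_C' C_to_V' V(2) C)
  moreover have "bij_betw (variety S) (insert (cong_of S F {}) ?C) ?V"
    by (intro bij_betwI[where g = "cong_of S F"] Pi_I V_to_C' C_to_V' V(2) C)
  moreover have iso: "semiringd_isomorphic (coordinate_semiring n F (variety S \<Omega>))
      (Pol_quot n S F (cong_of S F (variety S \<Omega>)))" for \<Omega>
    using assms(2) variety_subset by (rule R.coordinate_semiring_isomorphic)
  \<comment> \<open>Here \<open>\<Omega>\<close> is closed by \<open>C\<close>, so the quotient in
    \<open>iso\<close> is the quotient by \<open>\<Omega>\<close>.\<close>
  moreover have "semiringd_isomorphic (coordinate_semiring n F (variety S \<Omega>)) (Pol_quot n S F \<Omega>)"
    if "\<Omega> \<in> ?C" for \<Omega>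
    using iso[of \<Omega>] C that by simp
  ultimately show ?thesis
    using V(2) C
    by (intro conjI allI impI ballI)
      (simp_all add: variety_antimono cong_of_antimono variety_cong_of_variety
        R.cong_of_variety_cong_of)
qed

end
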